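(* Let $\mathcal{A},\mathcal{B}$ be Lie conformal superalgebras over $\mathbb{C}$ with $\mathcal{A}$ finite and simple, and let $f:\mathcal{A}\to\mathcal{B}$ be a (homogeneous) triple homomorphism. Let $E$ be the enveloping Lie conformal superalgebra of $f(\mathcal{A})$, and assume that $E$ is centerless and can be decomposed into a direct sum of indecomposable ideals. Then $f$ is either a homomorphism, or an anti-homomorphism, or a direct sum of a homomorphism and an anti-homomorphism from $\mathcal{A}$ to $\mathcal{B}$.
   Context: All vector spaces are over $\mathbb{C}$. A Lie conformal superalgebra is a $\mathbb{Z}_2$-graded $\mathbb{C}[\partial]$-module $\mathcal{R}=\mathcal{R}_{\bar 0}\oplus\mathcal{R}_{\bar 1}$ with a $\mathbb{C}$-linear map $\mathcal{R}\otimes\mathcal{R}\to\mathbb{C}[\lambda]\otimes\mathcal{R}$, $a\otimes b\mapsto[a_\lambda b]$, compatible with the grading (the bracket of elements of parities $i,j$ has coefficients of parity $i+j$), such that for homogeneous $a,b,c$ (with parities $|a|,|b|,|c|$): $[\partial a_\lambda b]=-\lambda[a_\lambda b]$, $[a_\lambda\partial b]=(\partial+\lambda)[a_\lambda b]$; $[a_\lambda b]=-(-1)^{|a||b|}[b_{-\lambda-\partial}a]$; $[a_\lambda[b_\mu c]]=[[a_\lambda b]_{\lambda+\mu}c]+(-1)^{|a||b|}[b_\mu[a_\lambda c]]$. Writing $[a_\lambda b]=\sum_n\frac{\lambda^n}{n!}a_{(n)}b$, a subalgebra is a $\mathbb{C}[\partial]$-submodule closed under all products $(n)$, $n\ge0$,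 and an ideal is a $\mathbb{C}[\partial]$-submodule $\mathcal I$ with $a_{(n)}\mathcal I\subseteq\mathcal I$ for all $a\in\mathcal R$, $n\ge0$. $\mathcal{R}$ is finite if it is finitely generated over $\mathbb{C}[\partial]$, simple if it is not abelian (bracket not identically zero) and has no non-trivial ideals, centerless if its center $Z(\mathcal{R})=\{a:[a_\lambda b]=0\ \forall b\in\mathcal{R}\}$ is $0$, and indecomposable if it cannot be written as a direct sum of two nontrivial ideals. A homogeneous $\mathbb{C}[\partial]$-module homomorphism $f:\mathcal{A}\to\mathcal{B}$ (one that maps $\mathcal{A}_i$ into $\mathcal{B}_{i+d}$ for a fixed $d$) is called a homomorphism if $f([a_\lambda b])=[f(a)_\lambda f(b)]$ for all $a,b$; an anti-homomorphism if $f([a_\lambda b])=-[f(a)_\lambda f(b)]$ for all $a,b$; a triple homomorphism if $f([a_\lambda[b_\mu c]])=[f(a)_\lambda[f(b)_\mu f(c)]]$ for all $a,b,c$. For a subset $S$ of a Lie conformal superalgebra, its enveloping Lie conformal superalgebra is the subalgebra generated by $S$. $f$ is called a direct sum of $f_1$ and $f_2$ if $f=f_1+f_2$ and there exist ideals $I_1,I_2$ of the enveloping Lie conformal superalgebra of $f(\mathcal{A})$ with $I_1\cap I_2=0$, $f_1(\mathcal{A})\subseteq I_1$, $f_2(\mathcal{A})\subseteq I_2$. *)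

theory Defs
  imports Complex_Main "HOL-Computational_Algebra.Polynomial" "HOL-Library.Z2"
begin

text \<open>
  The carrier of a superalgebra is the whole type \<open>'a\<close>; its subalgebras and ideals are subsets.
  The space \<open>\<complex>[\<lambda>] \<otimes> R\<close> is \<open>'a poly\<close>, so \<open>lbr A a b\<close> is the polynomial \<open>[a\<^sub>\<lambda> b]\<close> in \<open>\<lambda>\<close> with
  coefficients in \<open>R\<close>. The grading group \<open>\<int>/2\<close> is the type \<open>bit\<close>.
\<close>

record (overloaded) ('a::ab_group_add) lcs =
  smul :: "complex \<Rightarrow> 'a \<Rightarrow> 'a"
  der :: "'a \<Rightarrow> 'a"
  part :: "bit \<Rightarrow> 'a set"
  lbr :: "'a \<Rightarrow> 'a \<Rightarrow> 'a poly"

definition direct_sum2 :: "'a::ab_group_add set \<Rightarrow> 'a set \<Rightarrow> 'a set \<Rightarrow> bool" where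
  "direct_sum2 K I J \<longleftrightarrow> I \<inter> J = {0} \<and> K = {x + y | x y. x \<in> I \<and> y \<in> J}"

definition del_submodule :: "'a::ab_group_add lcs \<Rightarrow> 'a set \<Rightarrow> bool" where
  "del_submodule A N \<longleftrightarrow> module.subspace (smul A) N \<and> (\<forall>x\<in>N. der A x \<in> N)"

text \<open>
  \<open>psubst M \<iota> p\<close> is \<open>\<Sum>\<^sub>n M\<^sup>n (\<iota> p\<^sub>n)\<close>: the operator \<open>M\<close> is substituted for the indeterminate of
  \<open>p = \<Sum>\<^sub>n \<lambda>\<^sup>n p\<^sub>n\<close>, the coefficients being mapped by \<open>\<iota>\<close>.
\<close>

definition psubst :: "('c \<Rightarrow> 'c) \<Rightarrow> ('a \<Rightarrow> 'c) \<Rightarrow> 'a::zero poly \<Rightarrow> 'c::comm_monoid_add" where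
  "psubst M \<iota> p = (\<Sum>n\<le>degree p. (M ^^ n) (\<iota> (coeff p n)))"

text \<open>
  \<open>\<complex>[\<lambda>,\<mu>] \<otimes> R\<close> is \<open>'a poly poly\<close> with outer indeterminate \<open>\<mu>\<close> and inner indeterminate \<open>\<lambda>\<close>;
  \<open>mul_lam\<close> and \<open>mul_mu\<close> are the multiplications by \<open>\<lambda>\<close> and \<open>\<mu>\<close>.
\<close>

definition mul_lam :: "'a::ab_group_add poly poly \<Rightarrow> 'a poly poly" where
  "mul_lam P = map_poly (pCons 0) P"

definition mul_mu :: "'a::ab_group_add poly poly \<Rightarrow> 'a poly poly" where
  "mul_mu P = pCons 0 P"

definition const2 :: "'a::ab_group_add \<Rightarrow> 'a poly poly" where
  "const2 x = [:[:x:]:]"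

text \<open>\<open>[a\<^sub>\<lambda> [b\<^sub>\<mu> c]]\<close>\<close>

definition br_lam_mu :: "'a::ab_group_add lcs \<Rightarrow> 'a \<Rightarrow> 'a \<Rightarrow> 'a \<Rightarrow> 'a poly poly" where
  "br_lam_mu A a b c = psubst mul_mu (\<lambda>x. psubst mul_lam const2 (lbr A a x)) (lbr A b c)"

text \<open>\<open>[b\<^sub>\<mu> [a\<^sub>\<lambda> c]]\<close>\<close>

definition br_mu_lam :: "'a::ab_group_add lcs \<Rightarrow> 'a \<Rightarrow> 'a \<Rightarrow> 'a \<Rightarrow> 'a poly poly" where
  "br_mu_lam A b a c = psubst mul_lam (\<lambda>x. psubst mul_mu const2 (lbr A b x)) (lbr A a c)"

text \<open>\<open>[[a\<^sub>\<lambda> b]\<^bsub>\<lambda>+\<mu>\<^esub> c]\<close>\<close>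

definition br_lam_sum :: "'a::ab_group_add lcs \<Rightarrow> 'a \<Rightarrow> 'a \<Rightarrow> 'a \<Rightarrow> 'a poly poly" where
  "br_lam_sum A a b c =
    psubst mul_lam (\<lambda>x. psubst (\<lambda>P. mul_lam P + mul_mu P) const2 (lbr A x c)) (lbr A a b)"

text \<open>\<open>[b\<^bsub>-\<lambda>-\<partial>\<^esub> a]\<close>, where \<open>\<partial>\<close> acts on the coefficients\<close>

definition br_conj :: "'a::ab_group_add lcs \<Rightarrow> 'a \<Rightarrow> 'a \<Rightarrow> 'a poly" where
  "br_conj A b a = psubst (\<lambda>p. - pCons 0 p - map_poly (der A) p) (\<lambda>x. [:x:]) (lbr A b a)"

definition super_sign :: "bit \<Rightarrow> bit \<Rightarrow> 'c::ab_group_add \<Rightarrow> 'c" where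
  "super_sign i j x = (if i * j = 1 then - x else x)"

locale lie_conformal_superalgebra =
  fixes A :: "'a::ab_group_add lcs"
  assumes vector_space_smul: "vector_space (smul A)"
    and linear_der: "Vector_Spaces.linear (smul A) (smul A) (der A)"
    and part_submodule: "del_submodule A (part A i)"
    and part_direct_sum: "direct_sum2 UNIV (part A 0) (part A 1)"
    and lbr_add_left: "lbr A (a + a') b = lbr A a b + lbr A a' b"
    and lbr_add_right: "lbr A a (b + b') = lbr A a b + lbr A a b'"
    and lbr_smul_left: "lbr A (smul A z a) b = map_poly (smul A z) (lbr A a b)"
    and lbr_smul_right: "lbr A a (smul A z b) = map_poly (smul A z) (lbr A a b)"
    and lbr_graded: "a \<in> part A i \<Longrightarrow> b \<in> part A j \<Longrightarrow> coeff (lbr A a b) n \<in> part A (i + j)"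
    and lbr_der_left: "lbr A (der A a) b = - pCons 0 (lbr A a b)"
    and lbr_der_right: "lbr A a (der A b) = map_poly (der A) (lbr A a b) + pCons 0 (lbr A a b)"
    and skew_symmetry: "a \<in> part A i \<Longrightarrow> b \<in> part A j \<Longrightarrow>
      lbr A a b = - super_sign i j (br_conj A b a)"
    and jacobi: "a \<in> part A i \<Longrightarrow> b \<in> part A j \<Longrightarrow> c \<in> part A k \<Longrightarrow>
      br_lam_mu A a b c = br_lam_sum A a b c + super_sign i j (br_mu_lam A b a c)"

definition nprod :: "'a::ab_group_add lcs \<Rightarrow> nat \<Rightarrow> 'a \<Rightarrow> 'a \<Rightarrow> 'a" where
  "nprod A n a b = smul A (fact n) (coeff (lbr A a b) n)"

definition subalgebra :: "'a::ab_group_add lcs \<Rightarrow> 'a set \<Rightarrow> bool" where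
  "subalgebra A S \<longleftrightarrow> del_submodule A S \<and> (\<forall>n. \<forall>a\<in>S. \<forall>b\<in>S. nprod A n a b \<in> S)"

text \<open>
  In the following notions \<open>K\<close> is a subalgebra of \<open>A\<close>, regarded as an algebra in its own right.
  As in the definition of an ideal as a \<open>\<complex>[\<partial>]\<close>-submodule, compatibility with the grading is not
  required.
\<close>

definition ideal_of :: "'a::ab_group_add lcs \<Rightarrow> 'a set \<Rightarrow> 'a set \<Rightarrow> bool" where
  "ideal_of A K I \<longleftrightarrow>
    I \<subseteq> K \<and> del_submodule A I \<and> (\<forall>n. \<forall>a\<in>K. \<forall>x\<in>I. nprod A n a x \<in> I)"

definition center_of :: "'a::ab_group_add lcs \<Rightarrow> 'a set \<Rightarrow> 'a set" where
  "center_of A K = {a \<in> K. \<forall>b\<in>K. lbr A a b = 0}"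

definition centerless :: "'a::ab_group_add lcs \<Rightarrow> 'a set \<Rightarrow> bool" where
  "centerless A K \<longleftrightarrow> center_of A K = {0}"

definition indecomposable :: "'a::ab_group_add lcs \<Rightarrow> 'a set \<Rightarrow> bool" where
  "indecomposable A K \<longleftrightarrow>
    \<not> (\<exists>I J. ideal_of A K I \<and> ideal_of A K J \<and> I \<noteq> {0} \<and> J \<noteq> {0} \<and> direct_sum2 K I J)"

text \<open>
  \<open>K\<close> is the internal direct sum of the (possibly infinite) family \<open>F\<close>: each element of \<open>K\<close> has a
  unique finitely supported family of components.
\<close>

definition direct_sum_family :: "'a::ab_group_add set \<Rightarrow> 'a set set \<Rightarrow> bool" where
  "direct_sum_family K F \<longleftrightarrow> (\<forall>J\<in>F. J \<subseteq> K) \<and>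
    (\<forall>x\<in>K. \<exists>!g. (\<forall>J\<in>F. g J \<in> J) \<and> (\<forall>J. J \<notin> F \<longrightarrow> g J = 0) \<and>
      finite {J. g J \<noteq> 0} \<and> x = (\<Sum>J | g J \<noteq> 0. g J))"

definition sum_of_indecomposable_ideals :: "'a::ab_group_add lcs \<Rightarrow> 'a set \<Rightarrow> bool" where
  "sum_of_indecomposable_ideals A K \<longleftrightarrow>
    (\<exists>F. (\<forall>J\<in>F. ideal_of A K J \<and> indecomposable A J) \<and> direct_sum_family K F)"

definition finite_lcs :: "'a::ab_group_add lcs \<Rightarrow> bool" where
  "finite_lcs A \<longleftrightarrow> (\<exists>S. finite S \<and> \<Inter>{N. del_submodule A N \<and> S \<subseteq> N} = UNIV)"

definition simple_lcs :: "'a::ab_group_add lcs \<Rightarrow> bool" where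
  "simple_lcs A \<longleftrightarrow>
    (\<exists>a b. lbr A a b \<noteq> 0) \<and> (\<forall>I. ideal_of A UNIV I \<longrightarrow> I = {0} \<or> I = UNIV)"

definition enveloping :: "'a::ab_group_add lcs \<Rightarrow> 'a set \<Rightarrow> 'a set" where
  "enveloping A S = \<Inter>{T. subalgebra A T \<and> S \<subseteq> T}"

definition homogeneous_del_hom ::
    "'a::ab_group_add lcs \<Rightarrow> 'b::ab_group_add lcs \<Rightarrow> ('a \<Rightarrow> 'b) \<Rightarrow> bool" where
  "homogeneous_del_hom A B f \<longleftrightarrow>
    Vector_Spaces.linear (smul A) (smul B) f \<and> (\<forall>x. f (der A x) = der B (f x)) \<and>
    (\<exists>d. \<forall>i. f ` part A i \<subseteq> part B (i + d))"

definition lcs_hom :: "'a::ab_group_add lcs \<Rightarrow> 'b::ab_group_add lcs \<Rightarrow> ('a \<Rightarrow> 'b) \<Rightarrow> bool" where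
  "lcs_hom A B f \<longleftrightarrow> homogeneous_del_hom A B f \<and>
    (\<forall>a b. map_poly f (lbr A a b) = lbr B (f a) (f b))"

definition lcs_anti_hom :: "'a::ab_group_add lcs \<Rightarrow> 'b::ab_group_add lcs \<Rightarrow> ('a \<Rightarrow> 'b) \<Rightarrow> bool" where
  "lcs_anti_hom A B f \<longleftrightarrow> homogeneous_del_hom A B f \<and>
    (\<forall>a b. map_poly f (lbr A a b) = - lbr B (f a) (f b))"

definition lcs_triple_hom :: "'a::ab_group_add lcs \<Rightarrow> 'b::ab_group_add lcs \<Rightarrow> ('a \<Rightarrow> 'b) \<Rightarrow> bool" where
  "lcs_triple_hom A B f \<longleftrightarrow> homogeneous_del_hom A B f \<and>
    (\<forall>a b c. map_poly (map_poly f) (br_lam_mu A a b c) = br_lam_mu B (f a) (f b) (f c))"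

definition direct_sum_map ::
    "'b::ab_group_add lcs \<Rightarrow> ('a \<Rightarrow> 'b) \<Rightarrow> ('a \<Rightarrow> 'b) \<Rightarrow> ('a \<Rightarrow> 'b) \<Rightarrow> bool" where
  "direct_sum_map B f f1 f2 \<longleftrightarrow> (\<forall>x. f x = f1 x + f2 x) \<and>
    (\<exists>I1 I2. ideal_of B (enveloping B (range f)) I1 \<and> ideal_of B (enveloping B (range f)) I2 \<and>
      I1 \<inter> I2 = {0} \<and> range f1 \<subseteq> I1 \<and> range f2 \<subseteq> I2)"

end

theory Submission
  imports Defs
begin

text \<open>
  A simple algebra is perfect: every \<open>\<partial>\<close>-submodule containing all brackets is the whole algebra.
  Hence, \<open>E\<close> being centerless, each \<open>x\<close> has a unique companion \<open>g x\<close> in \<open>E\<close> with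
  \<open>f [z, x] = [f z, g x]\<close> for all \<open>z\<close>, and \<open>g [a, b] = [f a, f b]\<close>. If \<open>f\<close> is odd, comparing the signs
  in the two skew symmetries forces \<open>f = 0\<close>. If \<open>f\<close> is even, the Jacobi identity makes \<open>g\<close> a
  homomorphism. Then \<open>(f + g) / 2\<close> is a homomorphism, \<open>(f - g) / 2\<close> is an anti-homomorphism, and their
  images commute. So the images are ideals of \<open>E\<close>, and they meet in the center, which is zero.
\<close>

section \<open>Naturality of substitution\<close>

text \<open>Terms beyond the degree vanish. The freedom in \<open>N\<close> matters because
  \<open>map_poly k p\<close> can have smaller degree than \<open>p\<close>.\<close>

lemma psubst_eq_sum:
  assumes "degree p \<le> N" "M 0 = 0" "\<iota> 0 = 0"
  shows "psubst M \<iota> p = (\<Sum>n\<le>N. (M ^^ n) (\<iota> (coeff p n)))"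
proof -
  have "(M ^^ n) 0 = 0" for n
    by (induction n) (auto simp: assms)
  then show ?thesis
    unfolding psubst_def using assms
    by (intro sum.mono_neutral_left) (auto simp: coeff_eq_0)
qed

text \<open>The conjugate and iterated brackets are all built from \<open>psubst\<close>, so this
  single statement is what carries them along additive maps: \<open>h\<close> passes through the
  finite sum and through each power of \<open>M\<close>.\<close>

lemma psubst_natural:
  fixes h :: "'c::ab_group_add \<Rightarrow> 'd::ab_group_add"
  assumes h: "additive h" and M: "\<And>x. h (M x) = M' (h x)" and \<iota>: "\<And>x. h (\<iota> x) = \<iota>' (k x)"
    and "k 0 = 0" "M' 0 = 0" "\<iota>' 0 = 0"
  shows "h (psubst M \<iota> p) = psubst M' \<iota>' (map_poly k p)"
proof -
  have pow: "h ((M ^^ n) x) = (M' ^^ n) (h x)" for n x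
    by (induction n) (auto simp: M)
  have "h (psubst M \<iota> p) = (\<Sum>n\<le>degree p. (M' ^^ n) (\<iota>' (k (coeff p n))))"
    unfolding psubst_def by (simp add: additive.sum[OF h] pow \<iota>)
  also have "\<dots> = psubst M' \<iota>' (map_poly k p)"
    using assms by (subst psubst_eq_sum[where N = "degree p"])
      (auto simp: coeff_map_poly intro!: map_poly_degree_leq)
  finally show ?thesis .
qed

lemma additive_map_poly:
  assumes "additive h"
  shows "additive (map_poly h)"
  using assms by (intro additive.intro poly_eqI)
    (simp add: coeff_map_poly additive.zero additive.add)

lemma map_poly_mul_lam:
  assumes "additive h"
  shows "map_poly (map_poly h) (mul_lam P) = mul_lam (map_poly (map_poly h) P)"
  using assms unfolding mul_lam_def
  by (intro poly_eqI) (simp add: coeff_map_poly additive.zero coeff_pCons split: nat.split)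

lemma map_poly_mul_mu:
  assumes "additive h"
  shows "map_poly (map_poly h) (mul_mu P) = mul_mu (map_poly (map_poly h) P)"
  unfolding mul_mu_def by (simp add: map_poly_pCons)

lemma mul_lam_0: "mul_lam 0 = 0" and mul_mu_0: "mul_mu 0 = 0"
  by (simp_all add: mul_lam_def mul_mu_def)

lemma map_poly_const2:
  assumes "additive h"
  shows "map_poly (map_poly h) (const2 x) = const2 (h x)"
  using assms by (simp add: const2_def map_poly_pCons additive.zero)

text \<open>Substituting \<lambda> for the indeterminate changes nothing except that
  \<open>p\<close> becomes constant in \<mu>.\<close>

lemma psubst_mul_lam_const2: "psubst mul_lam const2 p = [:p:]"
proof -
  have pow: "(mul_lam ^^ n) (const2 x) = [:monom x n:]" for n and x :: 'a
    by (induction n) (auto simp: mul_lam_def const2_def map_poly_pCons monom_0 monom_Suc)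
  have "[:sum F I:] = (\<Sum>i\<in>I. [:F i:])" for F :: "nat \<Rightarrow> 'a poly" and I
    by (intro poly_eqI) (simp add: coeff_sum coeff_pCons split: nat.split)
  then show ?thesis
    unfolding psubst_def pow by (metis poly_as_sum_of_monoms)
qed

lemma psubst_mul_mu_pCons:
  fixes h :: "'a::ab_group_add \<Rightarrow> 'b::ab_group_add poly"
  assumes "h 0 = 0"
  shows "psubst mul_mu (\<lambda>x. [:h x:]) p = map_poly h p"
proof -
  have pow: "(mul_mu ^^ n) [:q:] = monom q n" for n and q :: "'b poly"
    by (induction n) (simp_all add: mul_mu_def monom_0 monom_Suc)
  have "psubst mul_mu (\<lambda>x. [:h x:]) p = (\<Sum>n\<le>degree p. monom (coeff (map_poly h p) n) n)"
    by (simp add: psubst_def pow coeff_map_poly assms)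
  then show ?thesis
    by (simp add: poly_as_sum_of_monoms' map_poly_degree_leq)
qed

lemma psubst_const2_natural:
  assumes "additive h" and "\<And>P. map_poly (map_poly h) (M P) = M' (map_poly (map_poly h) P)"
    and "M' 0 = 0"
  shows "map_poly (map_poly h) (psubst M const2 p) = psubst M' const2 (map_poly h p)"
  using assms by (intro psubst_natural additive_map_poly)
    (simp_all add: map_poly_const2 additive.zero, simp add: const2_def)

lemma map_poly_sum_lam_mu:
  assumes "additive h"
  shows "map_poly (map_poly h) (mul_lam P + mul_mu P) =
    mul_lam (map_poly (map_poly h) P) + mul_mu (map_poly (map_poly h) P)"
  using assms by (simp add: additive.add[OF additive_map_poly] additive_map_poly
      map_poly_mul_lam map_poly_mul_mu)

section \<open>Basic properties of brackets\<close>

context lie_conformal_superalgebra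
begin

sublocale vs: vector_space "smul A"
  by (rule vector_space_smul)

lemma additive_der: "additive (der A)"
  using linear_der by (simp add: additive_def Vector_Spaces.linear_iff)

lemma der_smul: "der A (smul A z x) = smul A z (der A x)"
  using linear_der by (simp add: Vector_Spaces.linear_iff)

lemma additive_lbr_left: "additive (\<lambda>a. lbr A a b)"
  by (simp add: additive_def lbr_add_left)

lemma additive_lbr_right: "additive (lbr A a)"
  by (simp add: additive_def lbr_add_right)

lemmas lbr_zero_left [simp] = additive.zero[OF additive_lbr_left]
lemmas lbr_zero_right [simp] = additive.zero[OF additive_lbr_right]

lemma coeff_lbr_smul:
  "coeff (lbr A (smul A z a) b) n = smul A z (coeff (lbr A a b) n)"
  "coeff (lbr A a (smul A z b)) n = smul A z (coeff (lbr A a b) n)"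
  by (simp_all add: lbr_smul_left lbr_smul_right coeff_map_poly)

lemma del_submoduleI:
  assumes "0 \<in> N" "\<And>x y. x \<in> N \<Longrightarrow> y \<in> N \<Longrightarrow> x + y \<in> N" "\<And>z x. x \<in> N \<Longrightarrow> smul A z x \<in> N"
    "\<And>x. x \<in> N \<Longrightarrow> der A x \<in> N"
  shows "del_submodule A N"
  using assms by (simp add: del_submodule_def vs.subspaceI)

lemma del_submoduleD:
  assumes "del_submodule A N"
  shows "0 \<in> N" "x \<in> N \<Longrightarrow> y \<in> N \<Longrightarrow> x + y \<in> N" "x \<in> N \<Longrightarrow> y \<in> N \<Longrightarrow> x - y \<in> N" "x \<in> N \<Longrightarrow> - x \<in> N"
    "x \<in> N \<Longrightarrow> smul A z x \<in> N" "x \<in> N \<Longrightarrow> der A x \<in> N"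
  using assms by (auto simp: del_submodule_def vs.subspace_0 vs.subspace_add vs.subspace_diff
      vs.subspace_neg vs.subspace_scale)

lemmas partD = del_submoduleD[OF part_submodule]

text \<open>The two elements differ by the invertible scalar \<open>fact n\<close>, so closure under
  the products can be tested on coefficients of the bracket.\<close>

lemma del_submodule_coeff_iff:
  assumes "del_submodule A N"
  shows "nprod A n a b \<in> N \<longleftrightarrow> coeff (lbr A a b) n \<in> N"
proof
  assume "nprod A n a b \<in> N"
  then have "smul A (1 / fact n) (nprod A n a b) \<in> N"
    by (rule del_submoduleD(5)[OF assms])
  then show "coeff (lbr A a b) n \<in> N"
    by (simp add: nprod_def)
qed (simp add: nprod_def del_submoduleD(5)[OF assms])

lemma homogeneous_decomp:
  obtains x0 x1 where "x0 \<in> part A 0" "x1 \<in> part A 1" "x = x0 + x1"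
  using part_direct_sum unfolding direct_sum2_def by blast

lemma part_Int_trivial:
  assumes "x \<in> part A i" "x \<in> part A (i + 1)"
  shows "x = 0"
  using part_direct_sum assms unfolding direct_sum2_def by (cases i) auto

lemma homogeneous_add_eq_0:
  assumes "x \<in> part A i" "y \<in> part A (i + 1)" "x + y = 0"
  shows "x = 0" "y = 0"
proof -
  have "y = - x"
    using assms(3) by (simp add: eq_neg_iff_add_eq_0 add.commute)
  with assms show "x = 0"
    by (metis part_Int_trivial partD(4) minus_minus)
  with \<open>y = - x\<close> show "y = 0" by simp
qed

text \<open>Since \<mu> is the outer indeterminate, an identity for \<open>br_lam_mu\<close> splits
  into one-variable identities, one for each power of \<mu>.\<close>

lemma coeff_br_lam_mu: "coeff (br_lam_mu A a b c) n = lbr A a (coeff (lbr A b c) n)"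
  unfolding br_lam_mu_def psubst_mul_lam_const2
  by (simp add: psubst_mul_mu_pCons coeff_map_poly)

lemma br_conj_eq_0: "lbr A b a = 0 \<Longrightarrow> br_conj A b a = 0"
  by (simp add: br_conj_def psubst_def)

lemma lbr_eq_0_commute:
  assumes "a \<in> part A i" "b \<in> part A j" "lbr A b a = 0"
  shows "lbr A a b = 0"
  using skew_symmetry[OF assms(1,2)] br_conj_eq_0[OF assms(3)] by (simp add: super_sign_def)

text \<open>Corresponding coefficients of the two brackets have opposite parities, so they cannot
  cancel each other.\<close>

lemma lbr_homogeneous_parts:
  assumes "a \<in> part A i" "x0 \<in> part A 0" "x1 \<in> part A 1" "lbr A a (x0 + x1) = 0"
  shows "lbr A a x0 = 0" "lbr A a x1 = 0"
proof -
  have "coeff (lbr A a x0) n = 0 \<and> coeff (lbr A a x1) n = 0" for n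
  proof -
    have "coeff (lbr A a x0) n \<in> part A i" "coeff (lbr A a x1) n \<in> part A (i + 1)"
      using lbr_graded[OF assms(1,2)] lbr_graded[OF assms(1,3)] by (simp_all only: add_0_right)
    moreover have "coeff (lbr A a x0) n + coeff (lbr A a x1) n = 0"
      using assms(4) by (metis lbr_add_right coeff_add coeff_0)
    ultimately show ?thesis
      using homogeneous_add_eq_0 by blast
  qed
  then show "lbr A a x0 = 0" "lbr A a x1 = 0"
    by (simp_all add: poly_eq_iff)
qed

text \<open>
  Working with the right factor makes the Jacobi identity say \<open>[y\<^sub>\<lambda> [b\<^sub>\<mu> c]] = 0\<close> directly, with no
  change of variables.
\<close>

lemma subalgebra_centralizer:
  assumes "y \<in> part A i"
  shows "subalgebra A {b. lbr A y b = 0}"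
proof -
  let ?C = "{b. lbr A y b = 0}"
  have sub: "del_submodule A ?C"
    by (rule del_submoduleI) (auto simp: lbr_add_right lbr_smul_right lbr_der_right)
  have hom: "lbr A y (coeff (lbr A b c) n) = 0"
    if "b \<in> part A j" "c \<in> part A k" "lbr A y b = 0" "lbr A y c = 0" for b c j k n
  proof -
    have "br_lam_sum A y b c = 0" "br_mu_lam A b y c = 0"
      using that by (simp_all add: br_lam_sum_def br_mu_lam_def psubst_def const2_def)
    then have "br_lam_mu A y b c = 0"
      using jacobi[OF assms that(1,2)] by (simp add: super_sign_def)
    then show ?thesis
      by (metis coeff_br_lam_mu coeff_0)
  qed
  have "coeff (lbr A b c) n \<in> ?C" if b: "b \<in> ?C" and c: "c \<in> ?C" for b c n
  proof -
    obtain b0 b1 where b': "b0 \<in> part A 0" "b1 \<in> part A 1" "b = b0 + b1"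
      by (rule homogeneous_decomp)
    obtain c0 c1 where c': "c0 \<in> part A 0" "c1 \<in> part A 1" "c = c0 + c1"
      by (rule homogeneous_decomp)
    have "lbr A y b0 = 0" "lbr A y b1 = 0" "lbr A y c0 = 0" "lbr A y c1 = 0"
      using lbr_homogeneous_parts[OF assms] b' c' b c by blast+
    then show ?thesis
      using hom b' c' by (simp add: lbr_add_left lbr_add_right)
  qed
  with sub show ?thesis
    unfolding subalgebra_def using del_submodule_coeff_iff[OF sub] by blast
qed

section \<open>Enveloping subalgebras and their centers\<close>

lemma subalgebra_enveloping: "subalgebra A (enveloping A S)"
proof -
  have "del_submodule A (enveloping A S)"
    unfolding enveloping_def
    by (rule del_submoduleI) (auto simp: subalgebra_def del_submoduleD)
  then show ?thesis
    by (auto simp: subalgebra_def enveloping_def)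
qed

lemma enveloping_superset: "S \<subseteq> enveloping A S"
  by (auto simp: enveloping_def)

lemma enveloping_least: "subalgebra A T \<Longrightarrow> S \<subseteq> T \<Longrightarrow> enveloping A S \<subseteq> T"
  by (auto simp: enveloping_def)

text \<open>The centralizer of a homogeneous element is a subalgebra, so it contains the enveloping
  algebra as soon as it contains \<open>S\<close>. This is applied to each homogeneous component of
  \<open>y\<close>; the components need not be known to lie in the enveloping algebra. The splitting
  of \<open>S\<close> allows skew symmetry to turn \<open>[s, y] = 0\<close> around.\<close>

lemma center_of_envelopingI:
  assumes S: "\<And>s. s \<in> S \<Longrightarrow> \<exists>s0\<in>S \<inter> part A 0. \<exists>s1\<in>S \<inter> part A 1. s = s0 + s1"
    and y: "y \<in> enveloping A S" "\<And>s. s \<in> S \<Longrightarrow> lbr A s y = 0"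
  shows "y \<in> center_of A (enveloping A S)"
proof -
  obtain y0 y1 where y': "y0 \<in> part A 0" "y1 \<in> part A 1" "y = y0 + y1"
    by (rule homogeneous_decomp)
  have hom: "lbr A y0 s = 0 \<and> lbr A y1 s = 0" if "s \<in> S" "s \<in> part A i" for s i
    using lbr_homogeneous_parts[OF that(2) y'(1,2)] y(2)[OF that(1)] y' that
    by (metis lbr_eq_0_commute)
  have "lbr A y0 s = 0 \<and> lbr A y1 s = 0" if "s \<in> S" for s
    using S[OF that] hom by (auto simp: lbr_add_right)
  then have "S \<subseteq> {b. lbr A y0 b = 0}" "S \<subseteq> {b. lbr A y1 b = 0}"
    by blast+
  then have "enveloping A S \<subseteq> {b. lbr A y0 b = 0}" "enveloping A S \<subseteq> {b. lbr A y1 b = 0}"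
    using y' by (simp_all add: enveloping_least subalgebra_centralizer)
  then show ?thesis
    using y(1) y'(3) by (auto simp: center_of_def lbr_add_left subset_iff)
qed

section \<open>Induction over brackets in a simple algebra\<close>

lemma simple_submodule_eq_UNIV:
  assumes "simple_lcs A" "del_submodule A N" "\<And>a b n. coeff (lbr A a b) n \<in> N"
  shows "N = UNIV"
proof -
  have "ideal_of A UNIV N"
    using assms del_submodule_coeff_iff by (auto simp: ideal_of_def)
  \<comment> \<open>A simple algebra is not abelian, so \<open>N\<close> contains a nonzero
    coefficient of some bracket.\<close>
  moreover have "N \<noteq> {0}"
    using assms(1,3) unfolding simple_lcs_def by (metis poly_eqI coeff_0 singletonD)
  ultimately show ?thesis
    using assms(1) by (auto simp: simple_lcs_def)
qed

text \<open>Graded form of the induction, with a separate condition for each parity. The sum of the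
  submodules \<open>part A i \<inter> N i\<close> contains all brackets, hence is everything, and
  uniqueness of homogeneous components gives the claim.\<close>

lemma simple_part_subset:
  assumes "simple_lcs A" and N: "\<And>i. del_submodule A (N i)"
    and br: "\<And>a b i j n. a \<in> part A i \<Longrightarrow> b \<in> part A j \<Longrightarrow> coeff (lbr A a b) n \<in> N (i + j)"
  shows "part A i \<subseteq> N i"
proof -
  let ?P = "\<lambda>i. part A i \<inter> N i"
  let ?N = "{x0 + x1 |x0 x1. x0 \<in> ?P 0 \<and> x1 \<in> ?P 1}"
  note P = del_submoduleD[OF N] partD
  have N_add: "x + y \<in> ?N" if xy: "x \<in> ?N" "y \<in> ?N" for x y
  proof -
    obtain x0 x1 where x: "x0 \<in> ?P 0" "x1 \<in> ?P 1" "x = x0 + x1"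
      using xy(1) by blast
    obtain y0 y1 where "y0 \<in> ?P 0" "y1 \<in> ?P 1" "y = y0 + y1"
      using xy(2) by blast
    with x have "x0 + y0 \<in> ?P 0" "x1 + y1 \<in> ?P 1" "x + y = (x0 + y0) + (x1 + y1)"
      by (auto intro: P simp: algebra_simps)
    then show ?thesis by blast
  qed
  have sub_N: "?P i \<subseteq> ?N" for i
  proof (cases "i = 0")
    case True
    then show ?thesis using P(1)[of 1] P(7)[of 1] by force
  next
    case False
    then show ?thesis using P(1)[of 0] P(7)[of 0] by force
  qed
  have "?N = UNIV"
  proof (rule simple_submodule_eq_UNIV[OF assms(1)])
    show "del_submodule A ?N"
    proof (rule del_submoduleI)
      show "0 \<in> ?N" using sub_N[of 0] P(1)[of 0] P(7)[of 0] by blast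
      show "smul A z x \<in> ?N" if x: "x \<in> ?N" for z x
      proof -
        obtain x0 x1 where "x0 \<in> ?P 0" "x1 \<in> ?P 1" "x = x0 + x1"
          using x by blast
        then have "smul A z x0 \<in> ?P 0" "smul A z x1 \<in> ?P 1"
          "smul A z x = smul A z x0 + smul A z x1"
          by (simp_all add: P vs.scale_right_distrib)
        then show ?thesis by blast
      qed
      show "der A x \<in> ?N" if x: "x \<in> ?N" for x
      proof -
        obtain x0 x1 where "x0 \<in> ?P 0" "x1 \<in> ?P 1" "x = x0 + x1"
          using x by blast
        then have "der A x0 \<in> ?P 0" "der A x1 \<in> ?P 1" "der A x = der A x0 + der A x1"
          by (simp_all add: P additive.add[OF additive_der])
        then show ?thesis by blast
      qed
    qed (rule N_add)
    have hom: "coeff (lbr A a b) n \<in> ?N" if "a \<in> part A i" "b \<in> part A j" for a b i j n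
      using sub_N br[OF that] lbr_graded[OF that] by blast
    show "coeff (lbr A a b) n \<in> ?N" for a b n
    proof -
      obtain a0 a1 where a: "a0 \<in> part A 0" "a1 \<in> part A 1" "a = a0 + a1"
        by (rule homogeneous_decomp)
      obtain b0 b1 where b: "b0 \<in> part A 0" "b1 \<in> part A 1" "b = b0 + b1"
        by (rule homogeneous_decomp)
      have "(coeff (lbr A a0 b0) n + coeff (lbr A a0 b1) n) +
          (coeff (lbr A a1 b0) n + coeff (lbr A a1 b1) n) \<in> ?N"
        using a b by (intro N_add) (rule hom; assumption)+
      then show ?thesis
        by (simp only: a b lbr_add_left lbr_add_right coeff_add add_ac)
    qed
  qed
  show ?thesis
  proof
    fix x assume x: "x \<in> part A i"
    obtain x0 x1 where *: "x0 \<in> ?P 0" "x1 \<in> ?P 1" "x = x0 + x1"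
      using \<open>?N = UNIV\<close> by blast
    show "x \<in> N i"
    proof (cases "i = 0")
      case True
      then have "x - x0 \<in> part A 0"
        using x * by (intro partD(3)) simp_all
      then have "x1 = 0"
        using * part_Int_trivial[of x1 0] by simp
      with * True show ?thesis by simp
    next
      case False
      then have "x - x1 \<in> part A 1"
        using x * by (intro partD(3)) simp_all
      then have "x0 = 0"
        using * part_Int_trivial[of x0 0] by simp
      with * False show ?thesis by simp
    qed
  qed
qed

end

text \<open>The targets \<open>a'\<close>, \<open>b'\<close>, \<open>c'\<close> are free parameters
  because a triple homomorphism transports a bracket only after one argument is replaced by its
  companion.\<close>

lemma br_lam_sum_natural:
  assumes "lie_conformal_superalgebra B" and h: "additive h" and k: "k 0 = 0"
    and inner: "\<And>w. map_poly h (lbr A w c) = lbr B (k w) c'"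
    and outer: "map_poly k (lbr A a b) = lbr B a' b'"
  shows "map_poly (map_poly h) (br_lam_sum A a b c) = br_lam_sum B a' b' c'"
proof -
  interpret B: lie_conformal_superalgebra B by fact
  have "map_poly (map_poly h) (psubst (\<lambda>P. mul_lam P + mul_mu P) const2 (lbr A w c)) =
      psubst (\<lambda>P. mul_lam P + mul_mu P) const2 (lbr B (k w) c')" for w
    unfolding inner[symmetric] using h
    by (intro psubst_const2_natural map_poly_sum_lam_mu) (simp_all add: mul_lam_0 mul_mu_0)
  then show ?thesis
    unfolding br_lam_sum_def outer[symmetric] using h k
    by (intro psubst_natural)
      (auto simp: additive_map_poly map_poly_mul_lam mul_lam_0, simp add: psubst_def const2_def)
qed

lemma br_mu_lam_natural:
  assumes "lie_conformal_superalgebra B" and h: "additive h" and k: "k 0 = 0"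
    and inner: "\<And>w. map_poly h (lbr A b w) = lbr B b' (k w)"
    and outer: "map_poly k (lbr A a c) = lbr B a' c'"
  shows "map_poly (map_poly h) (br_mu_lam A b a c) = br_mu_lam B b' a' c'"
proof -
  interpret B: lie_conformal_superalgebra B by fact
  have "map_poly (map_poly h) (psubst mul_mu const2 (lbr A b w)) =
      psubst mul_mu const2 (lbr B b' (k w))" for w
    unfolding inner[symmetric] using h
    by (intro psubst_const2_natural map_poly_mul_mu) (simp_all add: mul_mu_0)
  then show ?thesis
    unfolding br_mu_lam_def outer[symmetric] using h k
    by (intro psubst_natural)
      (auto simp: additive_map_poly map_poly_mul_lam mul_lam_0, simp add: psubst_def const2_def)
qed

text \<open>The substituted operator is \<open>-\<lambda> - \<partial>\<close>, which is why
  \<open>h\<close> must commute with the derivations. Only one bracket has to be transported, so the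
  statement serves \<open>f\<close> and its companion map alike.\<close>

lemma br_conj_natural:
  assumes "lie_conformal_superalgebra A" "lie_conformal_superalgebra B"
    and h: "additive h" and der: "\<And>x. h (der A x) = der B (h x)"
    and br: "map_poly h (lbr A b a) = lbr B b' a'"
  shows "map_poly h (br_conj A b a) = br_conj B b' a'"
proof -
  interpret A: lie_conformal_superalgebra A by fact
  interpret B: lie_conformal_superalgebra B by fact
  note 0 = additive.zero[OF h] additive.zero[OF A.additive_der] additive.zero[OF B.additive_der]
  have "map_poly h (- pCons 0 p - map_poly (der A) p) =
      - pCons 0 (map_poly h p) - map_poly (der B) (map_poly h p)" for p
    by (intro poly_eqI)
      (simp add: coeff_map_poly 0 additive.diff[OF h] additive.minus[OF h] der coeff_pCons
        split: nat.split)
  then show ?thesis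
    unfolding br_conj_def br[symmetric] using h
    by (intro psubst_natural) (auto simp: additive_map_poly 0 map_poly_pCons)
qed

section \<open>The companion of a triple homomorphism\<close>

locale centerless_triple_hom =
  A: lie_conformal_superalgebra A + B: lie_conformal_superalgebra B
  for A :: "'a::ab_group_add lcs" and B :: "'b::ab_group_add lcs" +
  fixes f :: "'a \<Rightarrow> 'b"
  assumes simple: "simple_lcs A"
    and triple_hom: "lcs_triple_hom A B f"
    and centerless: "centerless B (enveloping B (range f))"
begin

abbreviation E :: "'b set" where
  "E \<equiv> enveloping B (range f)"

lemma f_homogeneous_del_hom: "homogeneous_del_hom A B f"
  using triple_hom by (simp add: lcs_triple_hom_def)

lemma additive_f: "additive f"
  and f_smul: "f (smul A z x) = smul B z (f x)"
  and f_der: "f (der A x) = der B (f x)"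
  using f_homogeneous_del_hom
  by (auto simp: homogeneous_del_hom_def Vector_Spaces.linear_iff additive_def)

lemmas f_simps = additive.zero[OF additive_f] additive.add[OF additive_f] f_smul f_der

lemma f_in_E: "f x \<in> E"
  using B.enveloping_superset by blast

lemma del_submodule_E: "del_submodule B E"
  and coeff_in_E: "x \<in> E \<Longrightarrow> y \<in> E \<Longrightarrow> coeff (lbr B x y) n \<in> E"
  using B.subalgebra_enveloping[of "range f"] B.del_submodule_coeff_iff[of E]
  unfolding subalgebra_def by blast+

lemmas E_closed = B.del_submoduleD[OF del_submodule_E] coeff_in_E f_in_E

text \<open>The image of a homogeneous map is graded; for odd \<open>f\<close> the images of the
  even and odd components exchange roles.\<close>

lemma range_f_homogeneous:
  assumes "s \<in> range f"
  shows "\<exists>s0\<in>range f \<inter> part B 0. \<exists>s1\<in>range f \<inter> part B 1. s = s0 + s1"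
proof -
  obtain d where d: "\<And>i. f ` part A i \<subseteq> part B (i + d)"
    using f_homogeneous_del_hom by (auto simp: homogeneous_del_hom_def)
  obtain x where "s = f x"
    using assms by blast
  moreover obtain x0 x1 where x: "x0 \<in> part A 0" "x1 \<in> part A 1" "x = x0 + x1"
    by (rule A.homogeneous_decomp)
  ultimately have s: "s = f x0 + f x1" "s = f x1 + f x0"
    by (simp_all add: f_simps add.commute)
  have fx: "f x0 \<in> part B (0 + d)" "f x1 \<in> part B (1 + d)"
    using d x by blast+
  show ?thesis
  proof (cases "d = 0")
    case True
    with fx have "f x0 \<in> range f \<inter> part B 0" "f x1 \<in> range f \<inter> part B 1"
      by simp_all
    with s(1) show ?thesis by blast
  next
    case False
    with fx have "f x1 \<in> range f \<inter> part B 0" "f x0 \<in> range f \<inter> part B 1"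
      by simp_all
    with s(2) show ?thesis by blast
  qed
qed

text \<open>Such a \<open>y\<close> commutes with a graded generating set of \<open>E\<close>, so it
  is central. This is the form in which centerlessness is used.\<close>

lemma centralizer_trivial:
  assumes "y \<in> E" "\<And>z. lbr B (f z) y = 0"
  shows "y = 0"
  using B.center_of_envelopingI[OF range_f_homogeneous assms(1)] assms(2) centerless
  by (auto simp: centerless_def)

lemma map_f_triple:
  "map_poly f (lbr A a (coeff (lbr A b c) n)) = lbr B (f a) (coeff (lbr B (f b) (f c)) n)"
proof -
  have "map_poly (map_poly f) (br_lam_mu A a b c) = br_lam_mu B (f a) (f b) (f c)"
    using triple_hom by (simp add: lcs_triple_hom_def)
  then have "coeff (map_poly (map_poly f) (br_lam_mu A a b c)) n =
      coeff (br_lam_mu B (f a) (f b) (f c)) n"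
    by simp
  then show ?thesis
    by (simp add: coeff_map_poly A.coeff_br_lam_mu B.coeff_br_lam_mu)
qed

text \<open>A relation comes first because existence is proved by induction over brackets.
  Membership in \<open>E\<close> is what makes the companion unique.\<close>

definition companion :: "'a \<Rightarrow> 'b \<Rightarrow> bool" where
  "companion x y \<longleftrightarrow> y \<in> E \<and> (\<forall>z. map_poly f (lbr A z x) = lbr B (f z) y)"

lemma companion_unique:
  assumes "companion x y" "companion x y'"
  shows "y = y'"
proof -
  have "y - y' = 0"
    using assms unfolding companion_def
    by (intro centralizer_trivial)
      (auto intro: E_closed simp: additive.diff[OF B.additive_lbr_right])
  then show ?thesis by simp
qed

lemma companion_0: "companion 0 0"
  by (simp add: companion_def E_closed)

lemma companion_add: "companion x y \<Longrightarrow> companion x' y' \<Longrightarrow> companion (x + x') (y + y')"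
  by (simp add: companion_def E_closed A.lbr_add_right B.lbr_add_right
      additive.add[OF additive_map_poly[OF additive_f]])

lemma companion_smul: "companion x y \<Longrightarrow> companion (smul A c x) (smul B c y)"
  by (simp add: companion_def E_closed poly_eq_iff coeff_map_poly f_simps
      A.coeff_lbr_smul B.coeff_lbr_smul)

lemma companion_der: "companion x y \<Longrightarrow> companion (der A x) (der B y)"
  by (simp add: companion_def E_closed poly_eq_iff coeff_map_poly f_simps
      A.lbr_der_right B.lbr_der_right additive.zero[OF A.additive_der]
      additive.zero[OF B.additive_der] coeff_pCons split: nat.split)

text \<open>This is the triple homomorphism identity read off at \<open>\<mu>^n\<close>; it starts
  the induction for existence.\<close>

lemma companion_coeff: "companion (coeff (lbr A a b) n) (coeff (lbr B (f a) (f b)) n)"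
  by (simp add: companion_def E_closed map_f_triple)

lemma companion_exists: "\<exists>y. companion x y"
proof -
  have "{x. \<exists>y. companion x y} = UNIV"
  proof (rule A.simple_submodule_eq_UNIV[OF simple])
    show "del_submodule A {x. \<exists>y. companion x y}"
      by (rule A.del_submoduleI)
        (blast intro: companion_0 companion_add companion_smul companion_der)+
  qed (blast intro: companion_coeff)
  then show ?thesis by blast
qed

definition g :: "'a \<Rightarrow> 'b" where
  "g x = (THE y. companion x y)"

lemma companion_g: "companion x (g x)"
  unfolding g_def using companion_exists companion_unique by (metis the_equality)

lemma g_eqI: "companion x y \<Longrightarrow> g x = y"
  using companion_g companion_unique by blast

lemma additive_g: "additive g"
  by (intro additive.intro g_eqI companion_add companion_g)

lemma g_smul: "g (smul A c x) = smul B c (g x)"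
  by (intro g_eqI companion_smul companion_g)

lemma g_der: "g (der A x) = der B (g x)"
  by (intro g_eqI companion_der companion_g)

lemmas g_simps = additive.zero[OF additive_g] additive.add[OF additive_g] g_smul g_der

lemma g_in_E: "g x \<in> E"
  using companion_g by (auto simp: companion_def)

lemma map_g_lbr: "map_poly g (lbr A a b) = lbr B (f a) (f b)"
  by (intro poly_eqI) (simp add: coeff_map_poly g_simps g_eqI[OF companion_coeff])

lemma map_f_lbr: "map_poly f (lbr A z x) = lbr B (f z) (g x)"
  using companion_g by (auto simp: companion_def)

lemma f_coeff: "f (coeff (lbr A a b) n) = coeff (lbr B (f a) (g b)) n"
  by (metis map_f_lbr coeff_map_poly f_simps(1))

lemma g_coeff: "g (coeff (lbr A a b) n) = coeff (lbr B (f a) (f b)) n"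
  by (rule g_eqI[OF companion_coeff])

text \<open>
  If \<open>f\<close> is odd, the skew symmetries of \<open>A\<close> and of \<open>B\<close> carry opposite signs on brackets of elements
  of equal parity.
\<close>

lemma odd_imp_zero:
  assumes odd: "\<And>i. f ` part A i \<subseteq> part B (i + 1)"
  shows "f x = 0"
proof -
  have f_part: "f z \<in> part B (i + 1)" if "z \<in> part A i" for z i
    using odd that by blast
  have g_same: "g (coeff (lbr A z w) n) = 0" if zw: "z \<in> part A i" "w \<in> part A i" for z w i n
  proof -
    let ?X = "lbr B (f z) (f w)" and ?Y = "br_conj B (f w) (f z)"
    have map_neg: "map_poly g (- p) = - map_poly g p" for p
      by (rule additive.minus[OF additive_map_poly[OF additive_g]])
    have "map_poly g (br_conj A w z) = ?Y"
      using A.lie_conformal_superalgebra_axioms B.lie_conformal_superalgebra_axioms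
      by (rule br_conj_natural) (simp_all add: additive_g g_der map_g_lbr)
    moreover have "?X = map_poly g (- super_sign i i (br_conj A w z))"
      using A.skew_symmetry[OF zw] by (simp flip: map_g_lbr)
    ultimately have "?X = - super_sign i i ?Y"
      by (simp add: super_sign_def map_neg)
    moreover have "?X = - super_sign (i + 1) (i + 1) ?Y"
      by (rule B.skew_symmetry) (use f_part zw in blast)+
    \<comment> \<open>Exactly one of \<open>i\<close> and \<open>i + 1\<close> is odd, so the two
      expressions for \<open>?X\<close> have opposite signs.\<close>
    ultimately have "?X = - ?X"
      by (cases i) (auto simp: super_sign_def)
    then have "coeff ?X n + coeff ?X n = 0"
      by (metis coeff_minus add.right_inverse)
    then have "smul B 2 (coeff ?X n) = 0"
      by (metis B.vs.scale_left_distrib B.vs.scale_one one_add_one)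
    then show ?thesis
      by (simp add: g_coeff)
  qed
  \<comment> \<open>Even brackets come from factors of equal parity, where \<open>g\<close>
    vanishes; \<open>UNIV\<close> imposes nothing on the odd part.\<close>
  have "part A 0 \<subseteq> (if (0::bit) = 0 then {x. g x = 0} else UNIV)"
  proof (rule A.simple_part_subset[OF simple, where N = "\<lambda>i. if i = 0 then {x. g x = 0} else UNIV"])
    show "del_submodule A (if i = 0 then {x. g x = 0} else UNIV)" for i :: bit
      by (rule A.del_submoduleI) (auto simp: g_simps additive.zero[OF B.additive_der])
    show "coeff (lbr A a b) n \<in> (if i + j = 0 then {x. g x = 0} else UNIV)"
      if "a \<in> part A i" "b \<in> part A j" for a b i j n
      using that g_same by (cases i; cases j) auto
  qed
  then have g0: "g y = 0" if "y \<in> part A 0" for y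
    using that by auto
  have f_right: "f (coeff (lbr A z y) n) = 0" if "y \<in> part A 0" for z y n
    by (simp add: f_coeff g0[OF that])
  have f_left: "f (coeff (lbr A y z) n) = 0" if "y \<in> part A 0" "z \<in> part A 1" for z y n
  proof -
    have "map_poly f (br_conj A z y) = br_conj B (f z) 0"
      using A.lie_conformal_superalgebra_axioms B.lie_conformal_superalgebra_axioms
      by (rule br_conj_natural) (simp_all add: additive_f f_der map_f_lbr g0[OF that(1)])
    then have "map_poly f (br_conj A z y) = 0"
      by (simp add: B.br_conj_eq_0)
    then have "map_poly f (lbr A y z) = 0"
      using A.skew_symmetry[OF that]
      by (simp add: super_sign_def additive.minus[OF additive_map_poly[OF additive_f]])
    then show ?thesis
      by (metis coeff_map_poly f_simps(1) coeff_0)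
  qed
  have f_ker: "del_submodule A {x. f x = 0}"
    by (rule A.del_submoduleI) (auto simp: f_simps additive.zero[OF B.additive_der])
  \<comment> \<open>An odd bracket has exactly one even factor, and \<open>f\<close> kills it
    whichever side that factor is on.\<close>
  have "part A 1 \<subseteq> (if (1::bit) = 1 then {x. f x = 0} else UNIV)"
  proof (rule A.simple_part_subset[OF simple, where N = "\<lambda>i. if i = 1 then {x. f x = 0} else UNIV"])
    show "del_submodule A (if i = 1 then {x. f x = 0} else UNIV)" for i :: bit
      using f_ker A.del_submoduleI[of UNIV] by simp
    show "coeff (lbr A a b) n \<in> (if i + j = 1 then {x. f x = 0} else UNIV)"
      if "a \<in> part A i" "b \<in> part A j" for a b i j n
      using that f_left f_right by (cases i; cases j) auto
  qed
  then have f1: "f y = 0" if "y \<in> part A 1" for y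
    using that by auto
  \<comment> \<open>The remaining brackets have two odd factors, and there
    \<open>f [a, b] = [f a, g b]\<close> vanishes because \<open>f a = 0\<close>.\<close>
  have "part A i \<subseteq> {x. f x = 0}" for i
  proof (rule A.simple_part_subset[OF simple])
    show "coeff (lbr A a b) n \<in> {x. f x = 0}" if "a \<in> part A i" "b \<in> part A j" for a b i j n
      using that f_left f_right by (cases i; cases j) (auto simp: f_coeff f1)
  qed (rule f_ker)
  moreover obtain x0 x1 where "x0 \<in> part A 0" "x1 \<in> part A 1" "x = x0 + x1"
    by (rule A.homogeneous_decomp)
  ultimately show ?thesis
    by (auto simp: f_simps subset_iff)
qed

end

section \<open>Splitting an even triple homomorphism\<close>

locale even_triple_hom = centerless_triple_hom +
  assumes even: "f ` part A i \<subseteq> part B i"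
begin

lemma f_part: "x \<in> part A i \<Longrightarrow> f x \<in> part B i"
  using even by blast

text \<open>On brackets \<open>g\<close> is given by \<open>[f a, f b]\<close>, which has the right
  parity because \<open>f\<close> is even; induction over brackets does the rest.\<close>

lemma g_part:
  assumes "x \<in> part A i"
  shows "g x \<in> part B i"
proof -
  have "part A i \<subseteq> {x. g x \<in> part B i}"
  proof (rule A.simple_part_subset[OF simple])
    show "del_submodule A {x. g x \<in> part B i}" for i
      by (rule A.del_submoduleI) (auto simp: g_simps intro: B.partD)
  qed (simp only: mem_Collect_eq g_coeff B.lbr_graded f_part)
  with assms show ?thesis by blast
qed

text \<open>Both \<open>f\<close> and \<open>g\<close> preserve parity, so the skew symmetries of
  \<open>A\<close> and \<open>B\<close> carry the same sign and the companion can move to the left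
  factor.\<close>

lemma f_coeff_flip: "f (coeff (lbr A x z) n) = coeff (lbr B (g x) (f z)) n"
proof -
  have hom: "map_poly f (lbr A x z) = lbr B (g x) (f z)"
    if xz: "x \<in> part A i" "z \<in> part A j" for x z i j
  proof -
    have "map_poly f (br_conj A z x) = br_conj B (f z) (g x)"
      using A.lie_conformal_superalgebra_axioms B.lie_conformal_superalgebra_axioms
      by (rule br_conj_natural) (simp_all add: additive_f f_der map_f_lbr)
    then show ?thesis
      using A.skew_symmetry[OF xz] B.skew_symmetry[OF g_part[OF xz(1)] f_part[OF xz(2)]]
      by (simp add: super_sign_def additive.minus[OF additive_map_poly[OF additive_f]])
  qed
  obtain x0 x1 where x: "x0 \<in> part A 0" "x1 \<in> part A 1" "x = x0 + x1"
    by (rule A.homogeneous_decomp)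
  obtain z0 z1 where z: "z0 \<in> part A 0" "z1 \<in> part A 1" "z = z0 + z1"
    by (rule A.homogeneous_decomp)
  have "map_poly f (lbr A x z) = lbr B (g x) (f z)"
    using x z by (simp add: A.lbr_add_left A.lbr_add_right B.lbr_add_left B.lbr_add_right
        f_simps g_simps additive.add[OF additive_map_poly[OF additive_f]] hom)
  then show ?thesis
    by (metis coeff_map_poly f_simps(1))
qed

lemma map_f_lbr_flip: "map_poly f (lbr A x z) = lbr B (g x) (f z)"
  by (intro poly_eqI) (simp add: coeff_map_poly f_simps f_coeff_flip)

text \<open>
  Both \<open>A\<close> and \<open>B\<close> satisfy the Jacobi identity, so \<open>f [z, [x, y]] = [f z, [g x, g y]]\<close>; hence
  \<open>[g x, g y]\<close> is the companion of \<open>[x, y]\<close>.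
\<close>

lemma g_hom: "g (coeff (lbr A x y) n) = coeff (lbr B (g x) (g y)) n"
proof -
  have hom3: "map_poly f (lbr A z (coeff (lbr A x y) n)) = lbr B (f z) (coeff (lbr B (g x) (g y)) n)"
    if zxy: "z \<in> part A i" "x \<in> part A j" "y \<in> part A k" for z x y i j k n
  proof -
    note add = additive_map_poly[OF additive_map_poly[OF additive_f]]
    have "map_poly (map_poly f) (br_lam_sum A z x y) = br_lam_sum B (f z) (g x) (g y)"
      using B.lie_conformal_superalgebra_axioms by (rule br_lam_sum_natural[where k = f])
        (simp_all add: additive_f f_simps map_f_lbr)
    \<comment> \<open>The inner bracket becomes \<open>[f z, g y]\<close>; the outer one has
      \<open>x\<close> on the left and needs the flipped rule.\<close>
    moreover have "map_poly (map_poly f) (br_mu_lam A x z y) = br_mu_lam B (g x) (f z) (g y)"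
      using B.lie_conformal_superalgebra_axioms by (rule br_mu_lam_natural[where k = f])
        (simp_all add: additive_f f_simps map_f_lbr_flip flip: map_f_lbr)
    ultimately have "map_poly (map_poly f) (br_lam_mu A z x y) = br_lam_mu B (f z) (g x) (g y)"
      using A.jacobi[OF zxy] B.jacobi[OF f_part[OF zxy(1)] g_part[OF zxy(2)] g_part[OF zxy(3)]]
      by (simp add: super_sign_def additive.add[OF add] additive.minus[OF add])
    then have "coeff (map_poly (map_poly f) (br_lam_mu A z x y)) n =
        coeff (br_lam_mu B (f z) (g x) (g y)) n"
      by simp
    then show ?thesis
      by (simp add: coeff_map_poly A.coeff_br_lam_mu B.coeff_br_lam_mu)
  qed
  have hom2: "g (coeff (lbr A x y) n) = coeff (lbr B (g x) (g y)) n"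
    if xy: "x \<in> part A j" "y \<in> part A k" for x y j k n
  proof (rule g_eqI)
    have "map_poly f (lbr A z (coeff (lbr A x y) n)) = lbr B (f z) (coeff (lbr B (g x) (g y)) n)"
      for z
    proof -
      obtain z0 z1 where z: "z0 \<in> part A 0" "z1 \<in> part A 1" "z = z0 + z1"
        by (rule A.homogeneous_decomp)
      then show ?thesis
        by (simp add: A.lbr_add_left B.lbr_add_left f_simps
            additive.add[OF additive_map_poly[OF additive_f]] hom3[OF _ xy])
    qed
    then show "companion (coeff (lbr A x y) n) (coeff (lbr B (g x) (g y)) n)"
      by (simp add: companion_def E_closed g_in_E)
  qed
  obtain x0 x1 where x: "x0 \<in> part A 0" "x1 \<in> part A 1" "x = x0 + x1"
    by (rule A.homogeneous_decomp)
  obtain y0 y1 where y: "y0 \<in> part A 0" "y1 \<in> part A 1" "y = y0 + y1"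
    by (rule A.homogeneous_decomp)
  show ?thesis
    using x y by (simp add: A.lbr_add_left A.lbr_add_right B.lbr_add_left B.lbr_add_right
        g_simps hom2)
qed

text \<open>With \<open>f2\<close> below, this solves \<open>f = f1 + f2\<close> and
  \<open>g = f1 - f2\<close>.\<close>

definition f1 :: "'a \<Rightarrow> 'b" where
  "f1 x = smul B (1/2) (f x + g x)"

definition f2 :: "'a \<Rightarrow> 'b" where
  "f2 x = smul B (1/2) (f x - g x)"

lemma f_eq: "f x = f1 x + f2 x"
proof -
  have "f1 x + f2 x = smul B (1/2 + 1/2) (f x)"
    unfolding f1_def f2_def B.vs.scale_left_distrib
    by (simp add: B.vs.scale_right_distrib B.vs.scale_right_diff_distrib)
  then show ?thesis by simp
qed

lemma f1_f2_linear:
  "f1 0 = 0" "f1 (x + y) = f1 x + f1 y" "f1 (smul A c x) = smul B c (f1 x)"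
  "f1 (der A x) = der B (f1 x)"
  "f2 0 = 0" "f2 (x + y) = f2 x + f2 y" "f2 (smul A c x) = smul B c (f2 x)"
  "f2 (der A x) = der B (f2 x)"
  by (simp_all add: f1_def f2_def f_simps g_simps B.vs.scale_right_distrib B.der_smul
      B.vs.scale_right_diff_distrib additive.add[OF B.additive_der]
      additive.diff[OF B.additive_der] algebra_simps)

lemma f1_f2_in_E: "f1 x \<in> E" "f2 x \<in> E"
  by (simp_all add: f1_def f2_def E_closed g_in_E)

lemma f1_f2_homogeneous_del_hom: "homogeneous_del_hom A B f1" "homogeneous_del_hom A B f2"
proof -
  have "f1 ` part A i \<subseteq> part B (i + 0)" "f2 ` part A i \<subseteq> part B (i + 0)" for i
    unfolding f1_def f2_def add_0_right by (auto intro!: B.partD f_part g_part)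
  then show "homogeneous_del_hom A B f1" "homogeneous_del_hom A B f2"
    unfolding homogeneous_del_hom_def Vector_Spaces.linear_iff
    using f1_f2_linear A.vector_space_smul B.vector_space_smul by blast+
qed

text \<open>Expand using \<open>[f x, f y] = [g x, g y] = g [x, y]\<close> and
  \<open>[f x, g y] = [g x, f y] = f [x, y]\<close>: equal indices double the terms, mixed indices
  cancel them.\<close>

lemma coeff_lbr_half_sums:
  "coeff (lbr B (f1 x) (f1 y)) n = f1 (coeff (lbr A x y) n)"
  "coeff (lbr B (f2 x) (f2 y)) n = - f2 (coeff (lbr A x y) n)"
  "coeff (lbr B (f1 x) (f2 y)) n = 0"
  "coeff (lbr B (f2 x) (f1 y)) n = 0"
proof -
  have quarter: "smul B (1/4) (u + u) = smul B (1/2) u" for u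
  proof -
    have "smul B (1/4) (u + u) = smul B (1/4 + 1/4) u"
      by (simp only: B.vs.scale_left_distrib B.vs.scale_right_distrib)
    then show ?thesis by simp
  qed
  note br = B.coeff_lbr_smul B.lbr_add_left B.lbr_add_right coeff_add coeff_diff
    additive.diff[OF B.additive_lbr_left] additive.diff[OF B.additive_lbr_right]
    f_coeff[symmetric] f_coeff_flip[symmetric] g_coeff[symmetric] g_hom[symmetric]
  let ?c = "coeff (lbr A x y) n"
  have "coeff (lbr B (f1 x) (f1 y)) n = smul B (1/4) ((f ?c + g ?c) + (f ?c + g ?c))"
    by (simp add: f1_def br algebra_simps)
  then show "coeff (lbr B (f1 x) (f1 y)) n = f1 ?c"
    by (simp only: quarter f1_def)
  have "coeff (lbr B (f2 x) (f2 y)) n = smul B (1/4) ((g ?c - f ?c) + (g ?c - f ?c))"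
    by (simp add: f2_def br algebra_simps)
  then show "coeff (lbr B (f2 x) (f2 y)) n = - f2 ?c"
    by (simp only: quarter f2_def minus_diff_eq flip: B.vs.scale_minus_right)
  show "coeff (lbr B (f1 x) (f2 y)) n = 0" "coeff (lbr B (f2 x) (f1 y)) n = 0"
    by (simp_all add: f1_def f2_def br B.vs.scale_right_diff_distrib B.vs.scale_right_distrib)
qed

lemma lcs_hom_f1: "lcs_hom A B f1"
  by (simp add: lcs_hom_def f1_f2_homogeneous_del_hom poly_eq_iff coeff_map_poly f1_f2_linear
      coeff_lbr_half_sums)

lemma lcs_anti_hom_f2: "lcs_anti_hom A B f2"
  by (simp add: lcs_anti_hom_def f1_f2_homogeneous_del_hom poly_eq_iff coeff_map_poly f1_f2_linear
      coeff_lbr_half_sums)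

section \<open>The images of the two summands as ideals\<close>

lemma del_submodule_range: "del_submodule B (range f1)" "del_submodule B (range f2)"
  by (rule B.del_submoduleI; auto simp flip: f1_f2_linear(2-4,6-8)
      intro: range_eqI f1_f2_linear(1,5)[symmetric])+

text \<open>Letting \<open>x\<close> and \<open>y\<close> vary independently gives a subalgebra,
  because mixed brackets vanish; the image of \<open>f\<close> is its diagonal
  \<open>x = y\<close>.\<close>

lemma E_eq_sum:
  assumes "u \<in> E"
  obtains x y where "u = f1 x + f2 y"
proof -
  let ?T = "{f1 x + f2 y |x y. True}"
  have sum: "f1 x + f2 y \<in> ?T" for x y
    by blast
  have sub: "del_submodule B ?T"
  proof (rule B.del_submoduleI)
    show "0 \<in> ?T"
      using sum[of 0 0] by (simp add: f1_f2_linear)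
    show "u + v \<in> ?T" if uv: "u \<in> ?T" "v \<in> ?T" for u v
    proof -
      obtain x y x' y' where "u = f1 x + f2 y" "v = f1 x' + f2 y'"
        using uv by blast
      then have "u + v = f1 (x + x') + f2 (y + y')"
        by (simp add: f1_f2_linear)
      then show ?thesis by blast
    qed
    show "smul B c u \<in> ?T" if u: "u \<in> ?T" for c u
    proof -
      obtain x y where "u = f1 x + f2 y"
        using u by blast
      then have "smul B c u = f1 (smul A c x) + f2 (smul A c y)"
        by (simp add: f1_f2_linear B.vs.scale_right_distrib)
      then show ?thesis by blast
    qed
    show "der B u \<in> ?T" if u: "u \<in> ?T" for u
    proof -
      obtain x y where "u = f1 x + f2 y"
        using u by blast
      then have "der B u = f1 (der A x) + f2 (der A y)"
        by (simp add: f1_f2_linear additive.add[OF B.additive_der])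
      then show ?thesis by blast
    qed
  qed
  have "coeff (lbr B u v) n \<in> ?T" if uv: "u \<in> ?T" "v \<in> ?T" for u v n
  proof -
    obtain x y x' y' where "u = f1 x + f2 y" "v = f1 x' + f2 y'"
      using uv by blast
    \<comment> \<open>The sign of the anti-homomorphism is absorbed into the argument of
      \<open>f2\<close>.\<close>
    then have "coeff (lbr B u v) n =
        f1 (coeff (lbr A x x') n) + f2 (- coeff (lbr A y y') n)"
      by (simp add: B.lbr_add_left B.lbr_add_right coeff_lbr_half_sums
          additive.minus[OF additive.intro[OF f1_f2_linear(6)]])
    then show ?thesis by blast
  qed
  then have "subalgebra B ?T"
    unfolding subalgebra_def B.del_submodule_coeff_iff[OF sub] using sub by blast
  moreover have "range f \<subseteq> ?T"
    unfolding image_subset_iff by (simp only: f_eq) blast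
  ultimately have "E \<subseteq> ?T"
    by (rule B.enveloping_least)
  then have "u \<in> ?T"
    using assms by (rule subsetD)
  with that show thesis by blast
qed

text \<open>Writing an element of \<open>E\<close> as \<open>f1 x + f2 y\<close>, only the summand
  from the same image acts, and it acts inside that image.\<close>

lemma ideal_of_range: "ideal_of B E (range f1)" "ideal_of B E (range f2)"
proof -
  have "coeff (lbr B u (f1 z)) n \<in> range f1 \<and> coeff (lbr B u (f2 z)) n \<in> range f2"
    if "u \<in> E" for u z n
  proof -
    obtain x y where "u = f1 x + f2 y"
      using \<open>u \<in> E\<close> by (rule E_eq_sum)
    then have "coeff (lbr B u (f1 z)) n = f1 (coeff (lbr A x z) n)"
      "coeff (lbr B u (f2 z)) n = - f2 (coeff (lbr A y z) n)"
      by (simp_all add: B.lbr_add_left coeff_lbr_half_sums)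
    then show ?thesis
      using B.del_submoduleD(4)[OF del_submodule_range(2)] by auto
  qed
  then show "ideal_of B E (range f1)" "ideal_of B E (range f2)"
    unfolding ideal_of_def using del_submodule_range f1_f2_in_E
    by (auto simp: B.del_submodule_coeff_iff)
qed

text \<open>A common element is killed by \<open>f1 z\<close> as a value of \<open>f2\<close> and by
  \<open>f2 z\<close> as a value of \<open>f1\<close>, hence by \<open>f z\<close>.\<close>

lemma range_Int_trivial: "range f1 \<inter> range f2 = {0}"
proof -
  have "u = 0" if u: "u = f1 x" "u = f2 y" for u x y
  proof (rule centralizer_trivial)
    show "u \<in> E" by (simp add: u(1) f1_f2_in_E)
    fix z
    have "lbr B (f1 z) u = 0"
      unfolding u(2) by (rule poly_eqI) (simp add: coeff_lbr_half_sums)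
    moreover have "lbr B (f2 z) u = 0"
      unfolding u(1) by (rule poly_eqI) (simp add: coeff_lbr_half_sums)
    ultimately show "lbr B (f z) u = 0"
      by (simp add: f_eq B.lbr_add_left)
  qed
  moreover have "0 \<in> range f1" "0 \<in> range f2"
    using f1_f2_linear by (metis rangeI)+
  ultimately show ?thesis by blast
qed

lemma direct_sum_map_f1_f2: "direct_sum_map B f f1 f2"
  unfolding direct_sum_map_def
  using ideal_of_range range_Int_trivial by (intro conjI[OF allI[OF f_eq]]) blast

end

theorem theorem6p8:
  fixes A :: "'a::ab_group_add lcs" and B :: "'b::ab_group_add lcs" and f :: "'a \<Rightarrow> 'b"
  assumes "lie_conformal_superalgebra A"
    and "lie_conformal_superalgebra B"
    and "finite_lcs A"
    and "simple_lcs A"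
    and "lcs_triple_hom A B f"
    and "centerless B (enveloping B (range f))"
    and "sum_of_indecomposable_ideals B (enveloping B (range f))"
  shows "lcs_hom A B f \<or> lcs_anti_hom A B f \<or>
    (\<exists>f1 f2. lcs_hom A B f1 \<and> lcs_anti_hom A B f2 \<and> direct_sum_map B f f1 f2)"
proof -
  interpret centerless_triple_hom A B f
    using assms by (simp add: centerless_triple_hom_def centerless_triple_hom_axioms_def)
  obtain d where d: "\<And>i. f ` part A i \<subseteq> part B (i + d)"
    using f_homogeneous_del_hom by (auto simp: homogeneous_del_hom_def)
  show ?thesis
  proof (cases "d = 0")
    case True
    with d have "\<And>i. f ` part A i \<subseteq> part B i"
      by (simp only: add_0_right)
    then interpret even_triple_hom A B f
      by unfold_locales
    show ?thesis
      \<comment> \<open>For even \<open>f\<close> the third alternative always holds, possibly with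
        a zero summand.\<close>
      using lcs_hom_f1 lcs_anti_hom_f2 direct_sum_map_f1_f2 by blast
  next
    case False
    then have "d = 1" by simp
    \<comment> \<open>An odd \<open>f\<close> is the zero map, which is a homomorphism.\<close>
    have f0: "f x = 0" for x
      by (rule odd_imp_zero) (rule d[unfolded \<open>d = 1\<close>])
    have "map_poly f (lbr A a b) = lbr B (f a) (f b)" for a b
      by (rule poly_eqI) (simp add: coeff_map_poly f0)
    then have "lcs_hom A B f"
      using f_homogeneous_del_hom by (simp only: lcs_hom_def simp_thms)
    then show ?thesis ..
  qed
qed

end
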